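(* The following classes of maps (between non-empty path-connected spaces) are closed under arbitrary direct products, i.e. if $p_j:E_j\to X_j$, $j\in J$, is any family of maps in the class, then $\prod_j p_j:\prod_j E_j\to\prod_j X_j$ (product topologies) is in the class: (1) maps with the unique path-lifting property; (2) maps with the path-covering property; (3) maps with the continuous path-covering property; (4) Hurewicz fibrations with totally path-disconnected fibers; (5) Serre fibrations with totally path-disconnected fibers.
   Context: Maps are continuous. Let $I=[0,1]$. $P(Y,y)$ is the space of paths $\alpha:I\to Y$ with $\alpha(0)=y$, with the compact-open topology. For a map $p:E\to X$ and $e\in E$ let $P(p):P(E,e)\to P(X,p(e))$ be $\alpha\mapsto p\circ\alpha$. The map $p$ has the unique path-lifting property (resp. path-covering property, resp. continuous path-covering property) if $P(p):P(E,e)\to P(X,p(e))$ is injective (resp. bijective, resp. a homeomorphism) for every $e\in E$. A map $p:E\to X$ has the homotopy lifting property with respect to a space $Z$ if for all maps $f:Z\to E$ and $g:Z\times I\to X$ with $p(f(z))=g(z,0)$ for all $z$, there is a map $\widetilde{g}:Z\times I\to E$ with $p\circ\widetilde{g}=g$ and $\widetilde{g}(z,0)=f(z)$. A Hurewicz fibration has this property with respect to all spaces; a Serre fibration has it with respect to $I^n$ for all $n\ge0$. A space is totally path-disconnected if every path in it is constant. *)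

theory Defs
  imports "HOL-Analysis.Analysis"
begin

abbreviation unit_interval :: "real topology" where
  "unit_interval \<equiv> top_of_set {0..1}"

text \<open>
  Spaces are abstract topologies. A continuous map \<open>X \<rightarrow> Y\<close> is determined only on
  \<open>topspace X\<close>; the points of a mapping space are therefore taken in \<open>extensional (topspace X)\<close>,
  so that equal points are maps that agree on \<open>X\<close>.
\<close>

definition map_space :: "'a topology \<Rightarrow> 'b topology \<Rightarrow> ('a \<Rightarrow> 'b) set" where
  "map_space X Y = {f \<in> extensional (topspace X). continuous_map X Y f}"

definition compact_open_topology :: "'a topology \<Rightarrow> 'b topology \<Rightarrow> ('a \<Rightarrow> 'b) topology" where
  "compact_open_topology X Y =
     topology_generated_by {{f \<in> map_space X Y. f ` K \<subseteq> U} | K U. compactin X K \<and> openin Y U}"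

definition based_path_space :: "'a topology \<Rightarrow> 'a \<Rightarrow> (real \<Rightarrow> 'a) topology" where
  "based_path_space Y y =
     subtopology (compact_open_topology unit_interval Y) {\<alpha>. \<alpha> 0 = y}"

definition path_map :: "('e \<Rightarrow> 'x) \<Rightarrow> (real \<Rightarrow> 'e) \<Rightarrow> (real \<Rightarrow> 'x)" where
  "path_map p \<alpha> = restrict (p \<circ> \<alpha>) {0..1}"

definition unique_path_lifting :: "'e topology \<Rightarrow> 'x topology \<Rightarrow> ('e \<Rightarrow> 'x) \<Rightarrow> bool" where
  "unique_path_lifting E X p \<longleftrightarrow>
     (\<forall>e \<in> topspace E. inj_on (path_map p) (topspace (based_path_space E e)))"

definition path_covering :: "'e topology \<Rightarrow> 'x topology \<Rightarrow> ('e \<Rightarrow> 'x) \<Rightarrow> bool" where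
  "path_covering E X p \<longleftrightarrow>
     (\<forall>e \<in> topspace E. bij_betw (path_map p)
        (topspace (based_path_space E e)) (topspace (based_path_space X (p e))))"

definition continuous_path_covering :: "'e topology \<Rightarrow> 'x topology \<Rightarrow> ('e \<Rightarrow> 'x) \<Rightarrow> bool" where
  "continuous_path_covering E X p \<longleftrightarrow>
     (\<forall>e \<in> topspace E. homeomorphic_map
        (based_path_space E e) (based_path_space X (p e)) (path_map p))"

definition homotopy_lifting ::
    "'e topology \<Rightarrow> 'x topology \<Rightarrow> ('e \<Rightarrow> 'x) \<Rightarrow> 'z topology \<Rightarrow> bool" where
  "homotopy_lifting E X p Z \<longleftrightarrow>
     (\<forall>f g. continuous_map Z E f \<and> continuous_map (prod_topology Z unit_interval) X g \<and>
            (\<forall>z \<in> topspace Z. p (f z) = g (z, 0)) \<longrightarrow>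
       (\<exists>h. continuous_map (prod_topology Z unit_interval) E h \<and>
            (\<forall>z \<in> topspace Z. \<forall>t \<in> {0..1}. p (h (z, t)) = g (z, t)) \<and>
            (\<forall>z \<in> topspace Z. h (z, 0) = f z)))"

text \<open>
  A HOL formula cannot quantify over types, so ``all spaces'' is rendered as all topologies on
  one sufficiently large type. Lemma \<open>hurewicz_fibration_homotopy_lifting\<close> below shows that the
  choice of this type is immaterial: lifting follows for the topologies on every type.
\<close>

definition hurewicz_fibration :: "'e topology \<Rightarrow> 'x topology \<Rightarrow> ('e \<Rightarrow> 'x) \<Rightarrow> bool" where
  "hurewicz_fibration E X p \<longleftrightarrow>
     continuous_map E X p \<and>
     (\<forall>Z :: ('e \<times> (real \<Rightarrow> 'x)) topology. homotopy_lifting E X p Z)"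

definition cube :: "nat \<Rightarrow> (nat \<Rightarrow> real) topology" where
  "cube n = product_topology (\<lambda>_. unit_interval) {..<n}"

definition serre_fibration :: "'e topology \<Rightarrow> 'x topology \<Rightarrow> ('e \<Rightarrow> 'x) \<Rightarrow> bool" where
  "serre_fibration E X p \<longleftrightarrow>
     continuous_map E X p \<and> (\<forall>n. homotopy_lifting E X p (cube n))"

definition totally_path_disconnected :: "'a topology \<Rightarrow> bool" where
  "totally_path_disconnected Y \<longleftrightarrow>
     (\<forall>\<alpha>. pathin Y \<alpha> \<longrightarrow> (\<forall>s \<in> {0..1}. \<forall>t \<in> {0..1}. \<alpha> s = \<alpha> t))"

definition fiber :: "'e topology \<Rightarrow> ('e \<Rightarrow> 'x) \<Rightarrow> 'x \<Rightarrow> 'e topology" where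
  "fiber E p x = subtopology E {e. p e = x}"

definition totally_path_disconnected_fibers ::
    "'e topology \<Rightarrow> 'x topology \<Rightarrow> ('e \<Rightarrow> 'x) \<Rightarrow> bool" where
  "totally_path_disconnected_fibers E X p \<longleftrightarrow>
     (\<forall>x \<in> topspace X. totally_path_disconnected (fiber E p x))"

definition map_of_path_connected_spaces ::
    "'e topology \<Rightarrow> 'x topology \<Rightarrow> ('e \<Rightarrow> 'x) \<Rightarrow> bool" where
  "map_of_path_connected_spaces E X p \<longleftrightarrow>
     topspace E \<noteq> {} \<and> path_connected_space E \<and>
     topspace X \<noteq> {} \<and> path_connected_space X \<and>
     continuous_map E X p"

text \<open>
  Points of \<open>product_topology E J\<close> are extensional on \<open>J\<close>, hence the restriction. The factors
  \<open>E j\<close> have a common point type but arbitrary carriers \<open>topspace (E j)\<close>.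
\<close>

definition product_map :: "'j set \<Rightarrow> ('j \<Rightarrow> 'e \<Rightarrow> 'x) \<Rightarrow> ('j \<Rightarrow> 'e) \<Rightarrow> ('j \<Rightarrow> 'x)" where
  "product_map J p x = (\<lambda>j\<in>J. p j (x j))"


lemma topspace_compact_open_topology [simp]:
  "topspace (compact_open_topology X Y) = map_space X Y"
proof -
  have "map_space X Y \<in> {{f \<in> map_space X Y. f ` K \<subseteq> U} | K U. compactin X K \<and> openin Y U}"
    by (rule CollectI, rule exI[of _ "{}"], rule exI[of _ "{}"]) auto
  then show ?thesis
    unfolding compact_open_topology_def topology_generated_by_topspace by blast
qed

lemma continuous_map_evaluation:
  "continuous_map (prod_topology (compact_open_topology unit_interval X) unit_interval) X
     (\<lambda>(\<alpha>, t). \<alpha> t)"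
  unfolding continuous_map_def
proof (intro conjI allI impI)
  show "(\<lambda>(\<alpha>, t). \<alpha> t) \<in> topspace (prod_topology (compact_open_topology unit_interval X) unit_interval)
          \<rightarrow> topspace X"
    by (auto simp: map_space_def continuous_map_def Pi_iff)
next
  fix U assume U: "openin X U"
  let ?C = "compact_open_topology unit_interval X"
  let ?W = "{x \<in> topspace (prod_topology ?C unit_interval). (case x of (\<alpha>, t) \<Rightarrow> \<alpha> t) \<in> U}"
  show "openin (prod_topology ?C unit_interval) ?W"
    unfolding openin_prod_topology_alt
  proof (intro allI impI)
    fix \<alpha> t assume "(\<alpha>, t) \<in> ?W"
    then have \<alpha>: "\<alpha> \<in> map_space unit_interval X" and t: "t \<in> {0..1}" and atU: "\<alpha> t \<in> U"
      by auto
    have "openin unit_interval {s \<in> topspace unit_interval. \<alpha> s \<in> U}"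
      using \<alpha> U openin_continuous_map_preimage by (fastforce simp only: map_space_def mem_Collect_eq)
    then obtain T where T: "open T" and Teq: "{s \<in> {0..1}. \<alpha> s \<in> U} = {0..1} \<inter> T"
      by (auto simp: openin_open)
    have "t \<in> T" using Teq t atU by blast
    then obtain r where r: "r > 0" "cball t r \<subseteq> T"
      using T open_contains_cball by blast
    let ?K = "cball t r \<inter> {0..1}"
    let ?A = "{\<beta> \<in> map_space unit_interval X. \<beta> ` ?K \<subseteq> U}"
    let ?B = "{0..1} \<inter> ball t r"
    have "compactin unit_interval ?K"
      by (simp add: compactin_subtopology compact_Int)
    then have A: "openin ?C ?A"
      unfolding compact_open_topology_def
      by (intro topology_generated_by_Basis) (use U in blast)
    have B: "openin unit_interval ?B"
      by (rule openin_open_Int) simp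
    have "\<alpha> \<in> ?A" using \<alpha> r Teq by blast
    moreover have "t \<in> ?B" using t r by simp
    moreover have "?A \<times> ?B \<subseteq> ?W" by (auto simp: image_subset_iff)
    ultimately show "\<exists>A B. openin ?C A \<and> openin unit_interval B \<and> \<alpha> \<in> A \<and> t \<in> B \<and> A \<times> B \<subseteq> ?W"
      using A B by blast
  qed
qed

lemma continuous_map_adjoint:
  assumes g: "continuous_map (prod_topology Z Y) X g"
  shows "continuous_map Z (compact_open_topology Y X) (\<lambda>z. \<lambda>t\<in>topspace Y. g (z, t))"
proof -
  let ?\<phi> = "\<lambda>z. \<lambda>t\<in>topspace Y. g (z, t)"
  have \<phi>: "?\<phi> z \<in> map_space Y X" if "z \<in> topspace Z" for z
  proof -
    have "continuous_map Y (prod_topology Z Y) (\<lambda>t. (z, t))"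
      using that by (simp add: continuous_map_pairedI)
    from continuous_map_compose[OF this g] have "continuous_map Y X (\<lambda>t. g (z, t))"
      by (simp add: comp_def)
    then have "continuous_map Y X (?\<phi> z)"
      by (rule continuous_map_eq) simp
    then show ?thesis by (simp add: map_space_def)
  qed
  show ?thesis
    unfolding compact_open_topology_def
  proof (rule continuous_on_generated_topo)
    fix S assume "S \<in> {{f \<in> map_space Y X. f ` K \<subseteq> U} | K U. compactin Y K \<and> openin X U}"
    then obtain K U where S: "S = {f \<in> map_space Y X. f ` K \<subseteq> U}"
      and K: "compactin Y K" and U: "openin X U" by blast
    have KY: "K \<subseteq> topspace Y" using K by (rule compactin_subset_topspace)
    let ?W = "{x \<in> topspace (prod_topology Z Y). g x \<in> U}"
    have W: "openin (prod_topology Z Y) ?W"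
      using g U by (rule openin_continuous_map_preimage)
    have eq: "?\<phi> -` S \<inter> topspace Z = {z \<in> topspace Z. {z} \<times> K \<subseteq> ?W}"
      using \<phi> KY by (auto simp: S image_subset_iff subset_iff)
    show "openin Z (?\<phi> -` S \<inter> topspace Z)"
      unfolding eq
    proof (subst openin_subopen, intro ballI)
      fix z assume "z \<in> {z \<in> topspace Z. {z} \<times> K \<subseteq> ?W}"
      then have z: "z \<in> topspace Z" "{z} \<times> K \<subseteq> ?W" by auto
      have "compactin Z {z}" using z by simp
      then obtain A B where AB: "openin Z A" "openin Y B" "{z} \<subseteq> A" "K \<subseteq> B" "A \<times> B \<subseteq> ?W"
        using Wallace_theorem_prod_topology[OF _ K W z(2)] by blast
      then show "\<exists>T. openin Z T \<and> z \<in> T \<and> T \<subseteq> {z \<in> topspace Z. {z} \<times> K \<subseteq> ?W}"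
        using openin_subset[OF AB(1)] by (intro exI[of _ A]) blast
    qed
  next
    show "?\<phi> ` topspace Z \<subseteq> \<Union>{{f \<in> map_space Y X. f ` K \<subseteq> U} | K U. compactin Y K \<and> openin X U}"
      using \<phi> topspace_compact_open_topology[of Y X]
      unfolding compact_open_topology_def topology_generated_by_topspace by blast
  qed
qed

lemma hurewicz_fibration_homotopy_lifting:
  fixes Z :: "'z topology"
  assumes "hurewicz_fibration E X p"
  shows "homotopy_lifting E X p Z"
  unfolding homotopy_lifting_def
proof (intro allI impI, elim conjE)
  fix f g
  assume f: "continuous_map Z E f"
    and g: "continuous_map (prod_topology Z unit_interval) X g"
    and fg: "\<forall>z\<in>topspace Z. p (f z) = g (z, 0)"
  let ?C = "compact_open_topology unit_interval X"
  let ?N = "subtopology (prod_topology E ?C) {(e, \<alpha>). p e = \<alpha> 0}"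
  let ?ev = "\<lambda>x. snd (fst x) (snd x)"
  have ev: "continuous_map (prod_topology ?N unit_interval) X ?ev"
  proof -
    have "continuous_map (prod_topology ?N unit_interval) ?N fst"
      by (rule continuous_map_fst)
    then have "continuous_map (prod_topology ?N unit_interval) (prod_topology E ?C) fst"
      using continuous_map_into_fulltopology by blast
    then have "continuous_map (prod_topology ?N unit_interval) ?C (snd \<circ> fst)"
      by (rule continuous_map_compose) (rule continuous_map_snd)
    then have "continuous_map (prod_topology ?N unit_interval) (prod_topology ?C unit_interval)
          (\<lambda>x. ((snd \<circ> fst) x, snd x))"
      by (rule continuous_map_pairedI) (rule continuous_map_snd)
    from continuous_map_compose[OF this continuous_map_evaluation]
    show ?thesis by (simp add: comp_def)
  qed
  have fst: "continuous_map ?N E fst"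
    by (rule continuous_map_from_subtopology) (rule continuous_map_fst)
  have "homotopy_lifting E X p ?N"
    using assms by (simp add: hurewicz_fibration_def)
  moreover have "\<forall>z \<in> topspace ?N. p (fst z) = ?ev (z, 0)" by auto
  ultimately have "\<exists>h. continuous_map (prod_topology ?N unit_interval) E h \<and>
      (\<forall>z \<in> topspace ?N. \<forall>t \<in> {0..1}. p (h (z, t)) = ?ev (z, t)) \<and>
      (\<forall>z \<in> topspace ?N. h (z, 0) = fst z)"
    using fst ev unfolding homotopy_lifting_def by (elim allE[of _ fst] allE[of _ ?ev] impE) blast+
  then obtain h where h: "continuous_map (prod_topology ?N unit_interval) E h"
    and hp: "\<And>z t. z \<in> topspace ?N \<Longrightarrow> t \<in> {0..1} \<Longrightarrow> p (h (z, t)) = ?ev (z, t)"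
    and h0: "\<And>z. z \<in> topspace ?N \<Longrightarrow> h (z, 0) = fst z"
    by blast
  let ?\<phi> = "\<lambda>z. (f z, \<lambda>t\<in>topspace unit_interval. g (z, t))"
  have \<phi>: "continuous_map Z ?N ?\<phi>"
    unfolding continuous_map_in_subtopology
    using continuous_map_pairedI[OF f continuous_map_adjoint[OF g]] fg by auto
  then have \<phi>N: "?\<phi> z \<in> topspace ?N" if "z \<in> topspace Z" for z
    using that continuous_map_funspace by blast
  let ?h = "\<lambda>x. h (?\<phi> (fst x), snd x)"
  have "continuous_map (prod_topology Z unit_interval) ?N (?\<phi> \<circ> fst)"
    by (rule continuous_map_compose[OF continuous_map_fst \<phi>])
  then have "continuous_map (prod_topology Z unit_interval) (prod_topology ?N unit_interval)
      (\<lambda>x. ((?\<phi> \<circ> fst) x, snd x))"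
    by (rule continuous_map_pairedI) (rule continuous_map_snd)
  from continuous_map_compose[OF this h]
  have "continuous_map (prod_topology Z unit_interval) E ?h"
    by (simp add: comp_def)
  moreover have "p (?h (z, t)) = g (z, t)" if "z \<in> topspace Z" "t \<in> {0..1}" for z t
    using hp[OF \<phi>N[OF that(1)] that(2)] that by simp
  moreover have "?h (z, 0) = f z" if "z \<in> topspace Z" for z
    using h0[OF \<phi>N[OF that]] by simp
  ultimately show "\<exists>h. continuous_map (prod_topology Z unit_interval) E h \<and>
      (\<forall>z\<in>topspace Z. \<forall>t\<in>{0..1}. p (h (z, t)) = g (z, t)) \<and> (\<forall>z\<in>topspace Z. h (z, 0) = f z)"
    by blast
qed

end

theory Submission
  imports Defs
begin

text \<open>
  A path in a product is the tuple of its components, and likewise for homotopies, so injectivity,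
  bijectivity and lifting are checked and constructed coordinatewise. Continuity of maps into path
  spaces is handled by the exponential law: since the interval is locally compact,
  \<open>Z \<rightarrow> P(Y, y)\<close> is continuous iff the uncurried map \<open>Z \<times> I \<rightarrow> Y\<close> is, and the latter can be
  tested coordinatewise when \<open>Y\<close> is a product.
\<close>

section \<open>Based path spaces and the exponential law\<close>

lemma in_topspace_based_path_space:
  "\<alpha> \<in> topspace (based_path_space Y y) \<longleftrightarrow>
     \<alpha> \<in> extensional {0..1} \<and> continuous_map unit_interval Y \<alpha> \<and> \<alpha> 0 = y"
  by (auto simp: based_path_space_def map_space_def)

text \<open>From left to right, the uncurried map is \<open>F\<close> times the identity followed by
  evaluation, which is jointly continuous on the compact-open topology. From right to left,
  \<open>continuous_map_adjoint\<close> curries it back. The point of this form is that no later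
  argument has to handle subbasic open sets of a path space.\<close>

lemma continuous_map_based_path_space:
  "continuous_map Z (based_path_space Y y) F \<longleftrightarrow>
     (\<forall>z\<in>topspace Z. F z \<in> extensional {0..1} \<and> F z 0 = y) \<and>
     continuous_map (prod_topology Z unit_interval) Y (\<lambda>(z, t). F z t)"
  (is "?L \<longleftrightarrow> ?E \<and> ?R")
proof
  assume L: ?L
  then have F: "continuous_map Z (compact_open_topology unit_interval Y) F"
    unfolding based_path_space_def by (rule continuous_map_into_fulltopology)
  have E: ?E
    using continuous_map_funspace[OF L] by (auto simp: in_topspace_based_path_space Pi_iff)
  have "continuous_map (prod_topology Z unit_interval)
      (prod_topology (compact_open_topology unit_interval Y) unit_interval) (\<lambda>x. ((F \<circ> fst) x, snd x))"
    by (intro continuous_map_pairedI continuous_map_compose[OF continuous_map_fst F] continuous_map_snd)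
  from continuous_map_compose[OF this continuous_map_evaluation]
  have ?R by (simp add: comp_def case_prod_unfold)
  with E show "?E \<and> ?R" ..
next
  assume R: "?E \<and> ?R"
  have "continuous_map Z (compact_open_topology unit_interval Y) (\<lambda>z. \<lambda>t\<in>{0..1}. F z t)"
    using continuous_map_adjoint[of Z unit_interval Y "\<lambda>(z, t). F z t"] R by simp
  then have "continuous_map Z (compact_open_topology unit_interval Y) F"
    \<comment> \<open>Currying restricts each path to the interval; \<open>F z\<close> is already
      extensional there, so the restriction changes nothing.\<close>
    by (rule continuous_map_eq) (use R in \<open>auto simp: extensional_restrict\<close>)
  then show ?L
    using R by (auto simp: based_path_space_def continuous_map_in_subtopology)
qed

text \<open>By the exponential law it suffices that the uncurried map is continuous, and this is
  evaluation followed by \<open>p\<close>.\<close>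

lemma continuous_map_path_map:
  assumes "continuous_map E X p"
  shows "continuous_map (based_path_space E e) (based_path_space X (p e)) (path_map p)"
  unfolding continuous_map_based_path_space
proof (intro conjI ballI)
  have "continuous_map (prod_topology (based_path_space E e) unit_interval) E (\<lambda>(\<alpha>, t). \<alpha> t)"
    \<comment> \<open>Evaluation on the based path space is the uncurried form of its identity
      map.\<close>
    using continuous_map_based_path_space[of "based_path_space E e" E e "\<lambda>\<alpha>. \<alpha>"] by simp
  from continuous_map_compose[OF this assms]
  show "continuous_map (prod_topology (based_path_space E e) unit_interval) X
      (\<lambda>(\<alpha>, t). path_map p \<alpha> t)"
    by (rule continuous_map_eq) (auto simp: path_map_def)
qed (auto simp: path_map_def in_topspace_based_path_space)

lemma path_map_in_based_path_space:
  assumes "continuous_map E X p" and "\<alpha> \<in> topspace (based_path_space E e)"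
  shows "path_map p \<alpha> \<in> topspace (based_path_space X (p e))"
  using continuous_map_funspace[OF continuous_map_path_map[OF assms(1)]] assms(2) by blast

section \<open>Paths in a product and their components\<close>

text \<open>The outer restriction makes the result a point of a path space, the inner one makes each
  value a point of the product. The opposite operation, taking components, is written
  \<open>path_map (\<lambda>x. x j)\<close>, so that the facts about \<open>path_map\<close> apply
  to it with the projection as the map.\<close>

definition tuple_path :: "'j set \<Rightarrow> ('j \<Rightarrow> real \<Rightarrow> 'a) \<Rightarrow> real \<Rightarrow> 'j \<Rightarrow> 'a" where
  "tuple_path J \<phi> = (\<lambda>t\<in>{0..1}. \<lambda>j\<in>J. \<phi> j t)"

lemma path_map_component_tuple_path:
  assumes "j \<in> J" and "\<phi> j \<in> extensional {0..1}"
  shows "path_map (\<lambda>x. x j) (tuple_path J \<phi>) = \<phi> j"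
  using assms by (auto simp: path_map_def tuple_path_def extensional_def)

text \<open>Projecting after the product map is the same as applying \<open>p j\<close> after
  projecting. This naturality carries equations between paths in the products to the factors and
  back.\<close>

lemma path_map_component_product_map:
  assumes "j \<in> J"
  shows "path_map (\<lambda>x. x j) (path_map (product_map J p) \<alpha>) = path_map (p j) (path_map (\<lambda>x. x j) \<alpha>)"
  using assms by (auto simp: path_map_def product_map_def)

lemma path_map_component_in_based_path_space:
  assumes "j \<in> J" and "\<alpha> \<in> topspace (based_path_space (product_topology Y J) y)"
  shows "path_map (\<lambda>x. x j) \<alpha> \<in> topspace (based_path_space (Y j) (y j))"
  using path_map_in_based_path_space[OF continuous_map_product_projection] assms by fast

text \<open>Two layers of extensionality are involved: the paths are fixed outside the unit
  interval, and their values are fixed outside \<open>J\<close>. What remains is exactly the data in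
  the components.\<close>

lemma product_path_eqI:
  assumes \<alpha>: "\<alpha> \<in> topspace (based_path_space (product_topology Y J) y)"
    and \<beta>: "\<beta> \<in> topspace (based_path_space (product_topology Y J) y)"
    and eq: "\<And>j. j \<in> J \<Longrightarrow> path_map (\<lambda>x. x j) \<alpha> = path_map (\<lambda>x. x j) \<beta>"
  shows "\<alpha> = \<beta>"
proof (rule extensionalityI[of _ "{0..1}"])
  fix t :: real assume t: "t \<in> {0..1}"
  have ext: "\<gamma> t \<in> extensional J" if "\<gamma> \<in> topspace (based_path_space (product_topology Y J) y)" for \<gamma>
    using that t by (auto simp: in_topspace_based_path_space continuous_map_componentwise)
  show "\<alpha> t = \<beta> t"
  proof (rule extensionalityI[OF ext[OF \<alpha>] ext[OF \<beta>]])
    fix j assume "j \<in> J"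
    from fun_cong[OF eq[OF this], of t] t show "\<alpha> t j = \<beta> t j" by (simp add: path_map_def)
  qed
qed (use \<alpha> \<beta> in \<open>auto simp: in_topspace_based_path_space\<close>)

text \<open>After uncurrying, the claim concerns a map from \<open>Z\<close> times the interval into
  a product, whose coordinates are the uncurried \<open>F j\<close>; these are continuous by the
  exponential law in the other direction.\<close>

lemma continuous_map_tuple_path:
  assumes y: "y \<in> extensional J"
    and F: "\<And>j. j \<in> J \<Longrightarrow> continuous_map Z (based_path_space (Y j) (y j)) (F j)"
  shows "continuous_map Z (based_path_space (product_topology Y J) y) (\<lambda>z. tuple_path J (\<lambda>j. F j z))"
  unfolding continuous_map_based_path_space
proof (intro conjI ballI)
  fix z assume "z \<in> topspace Z"
  then show "tuple_path J (\<lambda>j. F j z) 0 = y"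
    \<comment> \<open>At time 0 the entries in \<open>J\<close> are those of \<open>y\<close>;
      outside \<open>J\<close> both sides are \<open>undefined\<close> because \<open>y\<close> is
      extensional.\<close>
    using F y by (auto simp: tuple_path_def continuous_map_based_path_space extensional_def)
  show "tuple_path J (\<lambda>j. F j z) \<in> extensional {0..1}"
    by (simp add: tuple_path_def)
next
  have "continuous_map (prod_topology Z unit_interval) (product_topology Y J)
      (\<lambda>(z, t). \<lambda>j\<in>J. F j z t)"
    using F by (auto simp: continuous_map_componentwise continuous_map_based_path_space case_prod_unfold)
  then show "continuous_map (prod_topology Z unit_interval) (product_topology Y J)
      (\<lambda>(z, t). tuple_path J (\<lambda>j. F j z) t)"
    by (rule continuous_map_eq) (auto simp: tuple_path_def)
qed

lemma tuple_path_in_based_path_space: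
  assumes "y \<in> extensional J" and "\<And>j. j \<in> J \<Longrightarrow> \<phi> j \<in> topspace (based_path_space (Y j) (y j))"
  shows "tuple_path J \<phi> \<in> topspace (based_path_space (product_topology Y J) y)"
proof -
  \<comment> \<open>A point of a space is a map from the one-point space, so membership is a special
    case of continuity.\<close>
  have "continuous_map (discrete_topology {()}) (based_path_space (product_topology Y J) y)
      (\<lambda>_. tuple_path J \<phi>)"
    using assms by (intro continuous_map_tuple_path) simp_all
  from continuous_map_funspace[OF this] show ?thesis by simp
qed

section \<open>Products of maps between path-connected spaces\<close>

lemma continuous_map_product_map:
  assumes "\<And>j. j \<in> J \<Longrightarrow> continuous_map (E j) (X j) (p j)"
  shows "continuous_map (product_topology E J) (product_topology X J) (product_map J p)"
  unfolding continuous_map_componentwise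
proof (intro conjI ballI)
  fix j assume j: "j \<in> J"
  from continuous_map_compose[OF continuous_map_product_projection[OF j, of E] assms[OF j]] j
  show "continuous_map (product_topology E J) (X j) (\<lambda>x. product_map J p x j)"
    by (simp add: product_map_def comp_def)
qed (auto simp: product_map_def)

lemma map_of_path_connected_spaces_product_map:
  assumes "\<And>j. j \<in> J \<Longrightarrow> map_of_path_connected_spaces (E j) (X j) (p j)"
  shows "map_of_path_connected_spaces
           (product_topology E J) (product_topology X J) (product_map J p)"
  using assms continuous_map_product_map[of J E X p]
  by (auto simp: map_of_path_connected_spaces_def PiE_eq_empty_iff path_connected_space_product_topology)

section \<open>Path lifting and path covering for products\<close>

text \<open>By naturality, the components of two lifts of the same path are lifts under
  \<open>p j\<close> of the same component, with common start \<open>e j\<close>. They agree by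
  uniqueness in each factor, and a path is determined by its components.\<close>

lemma unique_path_lifting_product_map:
  assumes p: "\<And>j. j \<in> J \<Longrightarrow> unique_path_lifting (E j) (X j) (p j)"
  shows "unique_path_lifting (product_topology E J) (product_topology X J) (product_map J p)"
  unfolding unique_path_lifting_def
proof (intro ballI inj_onI)
  fix e \<alpha> \<beta>
  assume e: "e \<in> topspace (product_topology E J)"
    and \<alpha>: "\<alpha> \<in> topspace (based_path_space (product_topology E J) e)"
    and \<beta>: "\<beta> \<in> topspace (based_path_space (product_topology E J) e)"
    and eq: "path_map (product_map J p) \<alpha> = path_map (product_map J p) \<beta>"
  show "\<alpha> = \<beta>"
  proof (rule product_path_eqI[OF \<alpha> \<beta>])
    fix j assume j: "j \<in> J"
    then have "inj_on (path_map (p j)) (topspace (based_path_space (E j) (e j)))"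
      using p e by (auto simp: unique_path_lifting_def)
    moreover have "path_map (p j) (path_map (\<lambda>x. x j) \<alpha>) = path_map (p j) (path_map (\<lambda>x. x j) \<beta>)"
      using path_map_component_product_map[OF j] eq by metis
    ultimately show "path_map (\<lambda>x. x j) \<alpha> = path_map (\<lambda>x. x j) \<beta>"
      using path_map_component_in_based_path_space[OF j] \<alpha> \<beta> by (blast dest: inj_onD)
  qed
qed

text \<open>Continuity of \<open>p\<close> puts the image of \<open>path_map p\<close> inside the
  target path space, so bijectivity splits into injectivity, which is already settled for products,
  and existence of lifts.\<close>

lemma path_covering_iff:
  assumes "continuous_map E X p"
  shows "path_covering E X p \<longleftrightarrow> unique_path_lifting E X p \<and>
    (\<forall>e\<in>topspace E. \<forall>\<beta>\<in>topspace (based_path_space X (p e)).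
       \<exists>\<alpha>\<in>topspace (based_path_space E e). path_map p \<alpha> = \<beta>)"
proof -
  have "path_map p ` topspace (based_path_space E e) = topspace (based_path_space X (p e)) \<longleftrightarrow>
      (\<forall>\<beta>\<in>topspace (based_path_space X (p e)). \<exists>\<alpha>\<in>topspace (based_path_space E e). path_map p \<alpha> = \<beta>)"
    for e
    using path_map_in_based_path_space[OF assms, of _ e] by (auto simp: image_iff set_eq_iff) metis+
  then show ?thesis
    unfolding path_covering_def unique_path_lifting_def bij_betw_def by blast
qed

lemma path_covering_product_map:
  assumes cont: "\<And>j. j \<in> J \<Longrightarrow> continuous_map (E j) (X j) (p j)"
    and p: "\<And>j. j \<in> J \<Longrightarrow> path_covering (E j) (X j) (p j)"
  shows "path_covering (product_topology E J) (product_topology X J) (product_map J p)"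
proof (subst path_covering_iff, intro continuous_map_product_map cont, assumption, intro conjI ballI)
  show "unique_path_lifting (product_topology E J) (product_topology X J) (product_map J p)"
    using p cont by (intro unique_path_lifting_product_map) (simp add: path_covering_iff)
next
  fix e \<beta>
  assume e: "e \<in> topspace (product_topology E J)"
    and \<beta>: "\<beta> \<in> topspace (based_path_space (product_topology X J) (product_map J p e))"
  have "\<exists>\<alpha>\<in>topspace (based_path_space (E j) (e j)). path_map (p j) \<alpha> = path_map (\<lambda>x. x j) \<beta>"
    if j: "j \<in> J" for j
  proof -
    have "path_map (\<lambda>x. x j) \<beta> \<in> topspace (based_path_space (X j) (p j (e j)))"
      using path_map_component_in_based_path_space[OF j \<beta>] j by (simp add: product_map_def)
    then show ?thesis
      using p[OF j] cont[OF j] e j by (auto simp: path_covering_iff)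
  qed
  \<comment> \<open>One lift per component of \<beta> is chosen, starting at \<open>e j\<close>;
    their tuple is the lift of \<beta> starting at \<open>e\<close>.\<close>
  then obtain \<phi> where \<phi>: "\<And>j. j \<in> J \<Longrightarrow> \<phi> j \<in> topspace (based_path_space (E j) (e j))"
    and \<phi>\<beta>: "\<And>j. j \<in> J \<Longrightarrow> path_map (p j) (\<phi> j) = path_map (\<lambda>x. x j) \<beta>"
    by metis
  have \<alpha>: "tuple_path J \<phi> \<in> topspace (based_path_space (product_topology E J) e)"
    using e \<phi> by (intro tuple_path_in_based_path_space) (auto simp: PiE_def)
  moreover have "path_map (product_map J p) (tuple_path J \<phi>) = \<beta>"
  proof (rule product_path_eqI[OF path_map_in_based_path_space[OF continuous_map_product_map[OF cont] \<alpha>] \<beta>])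
    fix j assume j: "j \<in> J"
    then have "\<phi> j \<in> extensional {0..1}"
      using \<phi> by (simp add: in_topspace_based_path_space)
    then show "path_map (\<lambda>x. x j) (path_map (product_map J p) (tuple_path J \<phi>)) = path_map (\<lambda>x. x j) \<beta>"
      using j \<phi>\<beta> by (simp add: path_map_component_product_map path_map_component_tuple_path)
  qed
  ultimately show "\<exists>\<alpha>\<in>topspace (based_path_space (product_topology E J) e).
      path_map (product_map J p) \<alpha> = \<beta>"
    by blast
qed

text \<open>Choosing continuous inverses \<open>q j\<close> of the factor maps gives an explicit
  inverse: split a path into components, apply each \<open>q j\<close>, and reassemble. Its
  continuity is where the exponential law is needed.\<close>

lemma continuous_path_covering_product_map:
  assumes cont: "\<And>j. j \<in> J \<Longrightarrow> continuous_map (E j) (X j) (p j)"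
    and p: "\<And>j. j \<in> J \<Longrightarrow> continuous_path_covering (E j) (X j) (p j)"
  shows "continuous_path_covering (product_topology E J) (product_topology X J) (product_map J p)"
  unfolding continuous_path_covering_def
proof
  fix e assume e: "e \<in> topspace (product_topology E J)"
  let ?PE = "based_path_space (product_topology E J) e"
  let ?PX = "based_path_space (product_topology X J) (product_map J p e)"
  have "\<exists>q. homeomorphic_maps (based_path_space (E j) (e j)) (based_path_space (X j) (p j (e j)))
      (path_map (p j)) q" if "j \<in> J" for j
    using p[OF that] e that by (auto simp: continuous_path_covering_def homeomorphic_map_maps)
  then obtain q where q: "\<And>j. j \<in> J \<Longrightarrow> homeomorphic_maps (based_path_space (E j) (e j))
      (based_path_space (X j) (p j (e j))) (path_map (p j)) (q j)"
    by metis
  let ?q = "\<lambda>\<beta>. tuple_path J (\<lambda>j. q j (path_map (\<lambda>x. x j) \<beta>))"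
  have f: "continuous_map ?PE ?PX (path_map (product_map J p))"
    by (intro continuous_map_path_map continuous_map_product_map cont)
  have g: "continuous_map ?PX ?PE ?q"
  proof (rule continuous_map_tuple_path)
    show "e \<in> extensional J" using e by (auto simp: PiE_def)
    fix j assume j: "j \<in> J"
    have "continuous_map ?PX (based_path_space (X j) (p j (e j))) (path_map (\<lambda>x. x j))"
      \<comment> \<open>Taking the component is continuous because it is \<open>path_map\<close> of
        a projection; its target is based at entry \<open>j\<close> of
        \<open>product_map J p e\<close>, which is \<open>p j (e j)\<close>.\<close>
      using continuous_map_path_map[OF continuous_map_product_projection[OF j],
          of X "product_map J p e"] j
      by (simp add: product_map_def)
    moreover have "continuous_map (based_path_space (X j) (p j (e j))) (based_path_space (E j) (e j)) (q j)"
      using q[OF j] by (simp add: homeomorphic_maps_def)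
    ultimately show "continuous_map ?PX (based_path_space (E j) (e j)) (\<lambda>\<beta>. q j (path_map (\<lambda>x. x j) \<beta>))"
      using continuous_map_compose by (fastforce simp: comp_def)
  qed
  \<comment> \<open>These two facts reduce both inverse laws to the factors: a component of the
    tuple is the value of \<open>q j\<close>, and \<open>q j\<close> is a right inverse on the
    components of \<beta>.\<close>
  have component_q: "path_map (\<lambda>x. x j) (?q \<beta>) = q j (path_map (\<lambda>x. x j) \<beta>)"
    and p_q: "path_map (p j) (q j (path_map (\<lambda>x. x j) \<beta>)) = path_map (\<lambda>x. x j) \<beta>"
    if j: "j \<in> J" and \<beta>: "\<beta> \<in> topspace ?PX" for j \<beta>
  proof -
    have \<beta>j: "path_map (\<lambda>x. x j) \<beta> \<in> topspace (based_path_space (X j) (p j (e j)))"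
      using path_map_component_in_based_path_space[OF j \<beta>] j by (simp add: product_map_def)
    then have "q j (path_map (\<lambda>x. x j) \<beta>) \<in> topspace (based_path_space (E j) (e j))"
      using q[OF j] by (auto simp: homeomorphic_maps_def continuous_map_def)
    then show "path_map (\<lambda>x. x j) (?q \<beta>) = q j (path_map (\<lambda>x. x j) \<beta>)"
      using j by (intro path_map_component_tuple_path) (auto simp: in_topspace_based_path_space)
    show "path_map (p j) (q j (path_map (\<lambda>x. x j) \<beta>)) = path_map (\<lambda>x. x j) \<beta>"
      using \<beta>j q[OF j] by (simp add: homeomorphic_maps_def)
  qed
  have f_in: "path_map (product_map J p) \<alpha> \<in> topspace ?PX" if "\<alpha> \<in> topspace ?PE" for \<alpha>
    using that f continuous_map_funspace by blast
  have g_in: "?q \<beta> \<in> topspace ?PE" if "\<beta> \<in> topspace ?PX" for \<beta>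
    using that continuous_map_funspace[OF g] by blast
  have "?q (path_map (product_map J p) \<alpha>) = \<alpha>" if \<alpha>: "\<alpha> \<in> topspace ?PE" for \<alpha>
  proof (rule product_path_eqI[OF g_in[OF f_in[OF \<alpha>]] \<alpha>])
    fix j assume j: "j \<in> J"
    have "q j (path_map (p j) (path_map (\<lambda>x. x j) \<alpha>)) = path_map (\<lambda>x. x j) \<alpha>"
      using q[OF j] path_map_component_in_based_path_space[OF j \<alpha>] by (simp add: homeomorphic_maps_def)
    then show "path_map (\<lambda>x. x j) (?q (path_map (product_map J p) \<alpha>)) = path_map (\<lambda>x. x j) \<alpha>"
      using component_q[OF j f_in[OF \<alpha>]] path_map_component_product_map[OF j, of p \<alpha>] by simp
  qed
  moreover have "path_map (product_map J p) (?q \<beta>) = \<beta>" if \<beta>: "\<beta> \<in> topspace ?PX" for \<beta>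
  proof (rule product_path_eqI[OF f_in[OF g_in[OF \<beta>]] \<beta>])
    fix j assume j: "j \<in> J"
    show "path_map (\<lambda>x. x j) (path_map (product_map J p) (?q \<beta>)) = path_map (\<lambda>x. x j) \<beta>"
      using path_map_component_product_map[OF j, of p "?q \<beta>"] component_q[OF j \<beta>] p_q[OF j \<beta>] by simp
  qed
  ultimately have "homeomorphic_maps ?PE ?PX (path_map (product_map J p)) ?q"
    using f g unfolding homeomorphic_maps_def by blast
  then show "homeomorphic_map ?PE ?PX (path_map (product_map J p))"
    by (rule homeomorphic_maps_map[THEN iffD1, THEN conjunct1])
qed

section \<open>Fibrations and their fibers\<close>

text \<open>A lifting problem for the product is a family of independent lifting problems for the
  factors over the same \<open>Z\<close>. Any choice of solutions assembles to a solution, since a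
  map into a product is continuous when its coordinates are.\<close>

lemma homotopy_lifting_product_map:
  assumes p: "\<And>j. j \<in> J \<Longrightarrow> homotopy_lifting (E j) (X j) (p j) Z"
  shows "homotopy_lifting (product_topology E J) (product_topology X J) (product_map J p) Z"
  unfolding homotopy_lifting_def
proof (intro allI impI, elim conjE)
  fix f g
  assume f: "continuous_map Z (product_topology E J) f"
    and g: "continuous_map (prod_topology Z unit_interval) (product_topology X J) g"
    and fg: "\<forall>z\<in>topspace Z. product_map J p (f z) = g (z, 0)"
  have "\<exists>h. continuous_map (prod_topology Z unit_interval) (E j) h \<and>
      (\<forall>z\<in>topspace Z. \<forall>t\<in>{0..1}. p j (h (z, t)) = g (z, t) j) \<and> (\<forall>z\<in>topspace Z. h (z, 0) = f z j)"
    if j: "j \<in> J" for j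
  proof -
    have "continuous_map Z (E j) (\<lambda>z. f z j)"
      and "continuous_map (prod_topology Z unit_interval) (X j) (\<lambda>x. g x j)"
      using f g j by (auto simp: continuous_map_componentwise)
    moreover have "p j (f z j) = g (z, 0) j" if "z \<in> topspace Z" for z
      \<comment> \<open>The equation is reversed so that \<open>g (z, 0)\<close> is rewritten to the
        tuple, whose entry at \<open>j\<close> is \<open>p j (f z j)\<close>.\<close>
      using fg[rule_format, OF that, symmetric] j by (simp add: product_map_def)
    ultimately show ?thesis
      using p[OF j, unfolded homotopy_lifting_def,
          rule_format, of "\<lambda>z. f z j" "\<lambda>x. g x j"] by blast
  qed
  then obtain h where h: "\<And>j. j \<in> J \<Longrightarrow> continuous_map (prod_topology Z unit_interval) (E j) (h j)"
    and ph: "\<And>j z t. \<lbrakk>j \<in> J; z \<in> topspace Z; t \<in> {0..1}\<rbrakk> \<Longrightarrow> p j (h j (z, t)) = g (z, t) j"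
    and h0: "\<And>j z. \<lbrakk>j \<in> J; z \<in> topspace Z\<rbrakk> \<Longrightarrow> h j (z, 0) = f z j"
    by metis
  let ?h = "\<lambda>x. \<lambda>j\<in>J. h j x"
  have "continuous_map (prod_topology Z unit_interval) (product_topology E J) ?h"
    using h by (auto simp: continuous_map_componentwise)
  moreover have "product_map J p (?h (z, t)) = g (z, t)" if "z \<in> topspace Z" "t \<in> {0..1}" for z t
  proof (rule extensionalityI[of _ J])
    show "g (z, t) \<in> extensional J"
      using g that by (auto simp: continuous_map_componentwise image_subset_iff)
  qed (use that ph in \<open>auto simp: product_map_def\<close>)
  moreover have "?h (z, 0) = f z" if "z \<in> topspace Z" for z
  proof (rule extensionalityI[of _ J])
    show "f z \<in> extensional J"
      using f that by (auto simp: continuous_map_componentwise image_subset_iff)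
  qed (use that h0 in auto)
  ultimately show "\<exists>h. continuous_map (prod_topology Z unit_interval) (product_topology E J) h \<and>
      (\<forall>z\<in>topspace Z. \<forall>t\<in>{0..1}. product_map J p (h (z, t)) = g (z, t)) \<and>
      (\<forall>z\<in>topspace Z. h (z, 0) = f z)"
    by (intro exI[of _ ?h]) blast
qed

text \<open>The definition tests lifting on topologies over a type built from the point types of the
  two spaces, and for the products this is a different type than for the factors.
  \<open>hurewicz_fibration_homotopy_lifting\<close> bridges the gap by giving the factors lifting
  over every type.\<close>

lemma hurewicz_fibration_product_map:
  assumes "\<And>j. j \<in> J \<Longrightarrow> hurewicz_fibration (E j) (X j) (p j)"
  shows "hurewicz_fibration (product_topology E J) (product_topology X J) (product_map J p)"
  unfolding hurewicz_fibration_def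
proof (intro conjI allI)
  show "continuous_map (product_topology E J) (product_topology X J) (product_map J p)"
    using assms by (intro continuous_map_product_map) (simp add: hurewicz_fibration_def)
qed (intro homotopy_lifting_product_map hurewicz_fibration_homotopy_lifting assms)

lemma serre_fibration_product_map:
  assumes "\<And>j. j \<in> J \<Longrightarrow> serre_fibration (E j) (X j) (p j)"
  shows "serre_fibration (product_topology E J) (product_topology X J) (product_map J p)"
  using assms
  by (auto simp: serre_fibration_def intro!: continuous_map_product_map homotopy_lifting_product_map)

text \<open>Each coordinate of a path in the fiber over \<open>x\<close> runs in the fiber of
  \<open>p j\<close> over \<open>x j\<close>, hence is constant.\<close>

lemma totally_path_disconnected_fibers_product_map:
  assumes p: "\<And>j. j \<in> J \<Longrightarrow> totally_path_disconnected_fibers (E j) (X j) (p j)"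
  shows "totally_path_disconnected_fibers
           (product_topology E J) (product_topology X J) (product_map J p)"
  unfolding totally_path_disconnected_fibers_def totally_path_disconnected_def
proof (intro ballI allI impI)
  fix x \<alpha> and s t :: real
  assume x: "x \<in> topspace (product_topology X J)"
    and \<alpha>: "pathin (fiber (product_topology E J) (product_map J p) x) \<alpha>"
    and st: "s \<in> {0..1}" "t \<in> {0..1}"
  have cont: "continuous_map unit_interval (product_topology E J) \<alpha>"
    and px: "\<And>u. u \<in> {0..1} \<Longrightarrow> product_map J p (\<alpha> u) = x"
    using \<alpha> by (auto simp: pathin_def fiber_def continuous_map_in_subtopology)
  show "\<alpha> s = \<alpha> t"
  proof (rule extensionalityI[of _ J])
    show "\<alpha> s \<in> extensional J" "\<alpha> t \<in> extensional J"
      using cont st by (auto simp: continuous_map_componentwise image_subset_iff)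
    fix j assume j: "j \<in> J"
    have "p j (\<alpha> u j) = x j" if "u \<in> {0..1}" for u
      using px[OF that, symmetric] j by (simp add: product_map_def)
    then have "pathin (fiber (E j) (p j) (x j)) (\<lambda>u. \<alpha> u j)"
      using cont j by (auto simp: pathin_def fiber_def continuous_map_in_subtopology continuous_map_componentwise)
    moreover have "x j \<in> topspace (X j)"
      using x j by auto
    ultimately show "\<alpha> s j = \<alpha> t j"
      using p[OF j] st
      unfolding totally_path_disconnected_fibers_def totally_path_disconnected_def by blast
  qed
qed

theorem lemma3p4:
  fixes J :: "'j set"
    and E :: "'j \<Rightarrow> 'e topology"
    and X :: "'j \<Rightarrow> 'x topology"
    and p :: "'j \<Rightarrow> 'e \<Rightarrow> 'x"
  assumes "\<And>j. j \<in> J \<Longrightarrow> map_of_path_connected_spaces (E j) (X j) (p j)"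
  shows "map_of_path_connected_spaces
           (product_topology E J) (product_topology X J) (product_map J p) \<and>
         ((\<forall>j\<in>J. unique_path_lifting (E j) (X j) (p j)) \<longrightarrow>
            unique_path_lifting (product_topology E J) (product_topology X J) (product_map J p)) \<and>
         ((\<forall>j\<in>J. path_covering (E j) (X j) (p j)) \<longrightarrow>
            path_covering (product_topology E J) (product_topology X J) (product_map J p)) \<and>
         ((\<forall>j\<in>J. continuous_path_covering (E j) (X j) (p j)) \<longrightarrow>
            continuous_path_covering (product_topology E J) (product_topology X J) (product_map J p)) \<and>
         ((\<forall>j\<in>J. hurewicz_fibration (E j) (X j) (p j) \<and>
                 totally_path_disconnected_fibers (E j) (X j) (p j)) \<longrightarrow>
            hurewicz_fibration (product_topology E J) (product_topology X J) (product_map J p) \<and>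
            totally_path_disconnected_fibers
              (product_topology E J) (product_topology X J) (product_map J p)) \<and>
         ((\<forall>j\<in>J. serre_fibration (E j) (X j) (p j) \<and>
                 totally_path_disconnected_fibers (E j) (X j) (p j)) \<longrightarrow>
            serre_fibration (product_topology E J) (product_topology X J) (product_map J p) \<and>
            totally_path_disconnected_fibers
              (product_topology E J) (product_topology X J) (product_map J p))"
proof -
  \<comment> \<open>The two lemmas on path covering take continuity of the factors as a separate
    hypothesis.\<close>
  have "\<And>j. j \<in> J \<Longrightarrow> continuous_map (E j) (X j) (p j)"
    using assms by (simp add: map_of_path_connected_spaces_def)
  then show ?thesis
    by (intro conjI impI map_of_path_connected_spaces_product_map assms
        unique_path_lifting_product_map path_covering_product_map
        continuous_path_covering_product_map hurewicz_fibration_product_map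
        serre_fibration_product_map totally_path_disconnected_fibers_product_map) blast+
qed

end
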